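(* Let $\mathcal{A}=(V,\Sigma,\delta)$ be a parameterized arena that is complete for enabled actions, let $t\in V$ be a target vertex, and let $\mathcal{K}$ be the associated knowledge game. Define the sets $W^i\subseteq V\times 2^{\mathbb{N}_{\geq 1}}$ by $W^0=\{(t,\mathbb{N}_{\geq 1})\}\cup\{(v,\emptyset)\mid v\in V\setminus\{t\}\}$ and $W^{i+1}=W^i\sqcup \mathrm{Pred}(\downarrow W^i)$ for $i\geq 0$. Then for every $v\in V$ and every $K\subseteq \mathbb{N}_{\geq 1}$ with $K\neq\emptyset$: Eve has a winning strategy from $(v,K)$ in $\mathcal{K}$ if and only if there exists $i\in\mathbb{N}$ such that $(v,K)\in\ \downarrow W^i$.
   Context: $\mathbb{N}_{\geq 1}$ denotes the positive integers (possible numbers of opponents). A parameterized arena is $\mathcal{A}=(V,\Sigma,\delta)$ with $V$ a finite set of vertices, $\Sigma$ a finite set of actions and $\delta:V\times\Sigma\times\mathbb{N}_{\geq 1}\to 2^V$. An action $a$ is enabled at $v$ if $\delta(v,a,k)\neq\emptyset$ for some $k$; $\mathrm{En}(v)$ is the set of enabled actions at $v$. The arena is complete for enabled actions: if $a\in\mathrm{En}(v)$ then $\delta(v,a,k)\neq\emptyset$ for all $k\in\mathbb{N}_{\geq1}$. For $v,v'\in V$, $a\in\Sigma$, let $\nabla(v,a,v')=\{k\in\mathbb{N}_{\geq 1}\mid v'\in\delta(v,a,k)\}$; it is assumed that every $\nabla(v,a,v')$ is a finite union of intervals. Knowledge game $\mathcal{K}$: a two-player turn-based reachability game between Eve and Adam.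 Eve's vertices are pairs $(v,K)$ with $v\in V$, $K\subseteq\mathbb{N}_{\geq1}$; Adam's vertices are triples $(v,K,a)$. Edges: $(v,K)\to(v,K,a)$ for every $a\in\mathrm{En}(v)$; and $(v,K,a)\to(v',K\cap\nabla(v,a,v'))$ for every $v'\in V$ with $K\cap\nabla(v,a,v')\neq\emptyset$. Target vertices are all $(t,K)$, $K\subseteq\mathbb{N}_{\geq 1}$. Eve has a winning strategy from a vertex if she has a strategy (choosing a successor at her vertices as a function of the history) such that every play consistent with it from that vertex visits a target vertex. Order: on Eve's vertices, $(v,K)\preceq(v',K')$ iff $v=v'$ and $K\subseteq K'$. For a set $L$ of Eve vertices, $\mathrm{Dom}(L)=\{x\mid \exists x'\in L,\ x\preceq x',\ x\neq x'\}$, $\lceil L\rceil=L\setminus\mathrm{Dom}(L)$ (maximal elements) and $\downarrow L=L\cup\mathrm{Dom}(L)$ (downward closure). The join is $L\sqcup L'=\lceil L\cup L'\rceil$. Operators: for a set $S$ of Eve vertices, $v\in V$, $a\in\Sigma$, let $\mathrm{KPred}_{v,a}(S)=\{K\subseteq\mathbb{N}_{\geq1}\mid \forall v'\in V:\ (v',K\cap\nabla(v,a,v'))\in S\}$, and $\mathrm{Pred}(S)=\bigcup_{v\in V}\bigcup_{a\in\mathrm{En}(v)}\{(v,K)\mid K\in\mathrm{KPred}_{v,a}(S)\}$. *)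

theory Defs
  imports Main
begin

section \<open>Parameterized arenas\<close>

record ('v, 'a) arena =
  verts :: "'v set"
  acts :: "'a set"
  succs :: "'v \<Rightarrow> 'a \<Rightarrow> nat \<Rightarrow> 'v set"

text \<open>The possible numbers of opponents are the elements of \<open>{1..}\<close>; the values of \<^const>\<open>succs\<close>
  outside \<open>verts \<times> acts \<times> {1..}\<close> are never used.\<close>

definition enabled :: "('v, 'a, 'm) arena_scheme \<Rightarrow> 'v \<Rightarrow> 'a set" where
  "enabled A v = {a \<in> acts A. \<exists>k\<ge>1. succs A v a k \<noteq> {}}"

definition nabla :: "('v, 'a, 'm) arena_scheme \<Rightarrow> 'v \<Rightarrow> 'a \<Rightarrow> 'v \<Rightarrow> nat set" where
  "nabla A v a v' = {k. 1 \<le> k \<and> v' \<in> succs A v a k}"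

definition nat_interval :: "nat set \<Rightarrow> bool" where
  "nat_interval I \<longleftrightarrow> (\<exists>l u. I = {l..u}) \<or> (\<exists>l. I = {l..})"

locale param_arena =
  fixes A :: "('v, 'a, 'm) arena_scheme"
  assumes finite_verts: "finite (verts A)"
    and finite_acts: "finite (acts A)"
    and succs_verts: "\<lbrakk>v \<in> verts A; a \<in> acts A; 1 \<le> k\<rbrakk> \<Longrightarrow> succs A v a k \<subseteq> verts A"
    and nabla_intervals: "\<lbrakk>v \<in> verts A; a \<in> acts A; v' \<in> verts A\<rbrakk>
      \<Longrightarrow> \<exists>F. finite F \<and> (\<forall>I\<in>F. nat_interval I) \<and> nabla A v a v' = \<Union>F"

definition complete_arena :: "('v, 'a, 'm) arena_scheme \<Rightarrow> bool" where
  "complete_arena A \<longleftrightarrow>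
    (\<forall>v\<in>verts A. \<forall>a\<in>enabled A v. \<forall>k\<ge>1. succs A v a k \<noteq> {})"


section \<open>Two-player reachability games\<close>

text \<open>A game is given by the set \<open>P\<close> of Eve's vertices, the edge relation \<open>E\<close> and the target set
  \<open>T\<close>. Plays are maximal paths: either infinite, or finite and ending in a vertex without
  successor. Hence a finite play that is stuck before having visited a target is lost for Eve,
  whoever owns its last vertex.\<close>

definition history :: "('p \<times> 'p) set \<Rightarrow> 'p list \<Rightarrow> bool" where
  "history E h \<longleftrightarrow> h \<noteq> [] \<and> successively (\<lambda>x y. (x, y) \<in> E) h"

text \<open>A strategy need not be legal on histories whose last vertex has no successor, since there
  is nothing to choose.\<close>

definition eve_strategy :: "'p set \<Rightarrow> ('p \<times> 'p) set \<Rightarrow> ('p list \<Rightarrow> 'p) \<Rightarrow> bool" where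
  "eve_strategy P E \<sigma> \<longleftrightarrow>
    (\<forall>h. history E h \<longrightarrow> last h \<in> P \<longrightarrow> last h \<in> Domain E \<longrightarrow> (last h, \<sigma> h) \<in> E)"

definition infinite_play ::
  "'p set \<Rightarrow> ('p \<times> 'p) set \<Rightarrow> ('p list \<Rightarrow> 'p) \<Rightarrow> 'p \<Rightarrow> (nat \<Rightarrow> 'p) \<Rightarrow> bool" where
  "infinite_play P E \<sigma> x \<rho> \<longleftrightarrow> \<rho> 0 = x \<and> (\<forall>i. (\<rho> i, \<rho> (Suc i)) \<in> E) \<and>
    (\<forall>i. \<rho> i \<in> P \<longrightarrow> \<rho> (Suc i) = \<sigma> (map \<rho> [0..<Suc i]))"

definition finite_play ::
  "'p set \<Rightarrow> ('p \<times> 'p) set \<Rightarrow> ('p list \<Rightarrow> 'p) \<Rightarrow> 'p \<Rightarrow> 'p list \<Rightarrow> bool" where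
  "finite_play P E \<sigma> x h \<longleftrightarrow> history E h \<and> hd h = x \<and> last h \<notin> Domain E \<and>
    (\<forall>i. Suc i < length h \<longrightarrow> h ! i \<in> P \<longrightarrow> h ! Suc i = \<sigma> (take (Suc i) h))"

definition eve_wins_from :: "'p set \<Rightarrow> ('p \<times> 'p) set \<Rightarrow> 'p set \<Rightarrow> 'p \<Rightarrow> bool" where
  "eve_wins_from P E T x \<longleftrightarrow> (\<exists>\<sigma>. eve_strategy P E \<sigma> \<and>
    (\<forall>\<rho>. infinite_play P E \<sigma> x \<rho> \<longrightarrow> (\<exists>i. \<rho> i \<in> T)) \<and>
    (\<forall>h. finite_play P E \<sigma> x h \<longrightarrow> (\<exists>y\<in>set h. y \<in> T)))"


section \<open>The knowledge game\<close>

datatype ('v, 'a) kvertex = Eve 'v "nat set" | Adam 'v "nat set" 'a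

definition eve_vertices :: "('v, 'a, 'm) arena_scheme \<Rightarrow> ('v, 'a) kvertex set" where
  "eve_vertices A = {Eve v K | v K. v \<in> verts A \<and> K \<subseteq> {1..}}"

definition knowledge_edges ::
  "('v, 'a, 'm) arena_scheme \<Rightarrow> (('v, 'a) kvertex \<times> ('v, 'a) kvertex) set" where
  "knowledge_edges A =
    {(Eve v K, Adam v K a) | v K a. v \<in> verts A \<and> K \<subseteq> {1..} \<and> a \<in> enabled A v} \<union>
    {(Adam v K a, Eve v' (K \<inter> nabla A v a v')) | v K a v'.
       v \<in> verts A \<and> K \<subseteq> {1..} \<and> a \<in> acts A \<and> v' \<in> verts A \<and> K \<inter> nabla A v a v' \<noteq> {}}"

definition knowledge_targets :: "'v \<Rightarrow> ('v, 'a) kvertex set" where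
  "knowledge_targets t = {Eve t K | K. K \<subseteq> {1..}}"

definition eve_wins_knowledge ::
  "('v, 'a, 'm) arena_scheme \<Rightarrow> 'v \<Rightarrow> 'v \<Rightarrow> nat set \<Rightarrow> bool" where
  "eve_wins_knowledge A t v K \<longleftrightarrow>
    eve_wins_from (eve_vertices A) (knowledge_edges A) (knowledge_targets t) (Eve v K)"


section \<open>Sets of Eve's vertices and the fixpoint iteration\<close>

text \<open>In this part, the vertex \<^term>\<open>Eve v K\<close> is represented by the pair \<^term>\<open>(v, K)\<close>.\<close>

type_synonym 'v kpair = "'v \<times> nat set"

definition kle :: "'v kpair \<Rightarrow> 'v kpair \<Rightarrow> bool" (infix "\<preceq>" 50) where
  "x \<preceq> y \<longleftrightarrow> fst x = fst y \<and> snd x \<subseteq> snd y"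

definition Dom :: "'v kpair set \<Rightarrow> 'v kpair set" where
  "Dom L = {x. \<exists>x'\<in>L. x \<preceq> x' \<and> x \<noteq> x'}"

definition maximals :: "'v kpair set \<Rightarrow> 'v kpair set" where
  "maximals L = L - Dom L"

definition down :: "'v kpair set \<Rightarrow> 'v kpair set" where
  "down L = L \<union> Dom L"

definition join :: "'v kpair set \<Rightarrow> 'v kpair set \<Rightarrow> 'v kpair set" where
  "join L L' = maximals (L \<union> L')"

definition KPred ::
  "('v, 'a, 'm) arena_scheme \<Rightarrow> 'v \<Rightarrow> 'a \<Rightarrow> 'v kpair set \<Rightarrow> nat set set" where
  "KPred A v a S = {K. K \<subseteq> {1..} \<and> (\<forall>v'\<in>verts A. (v', K \<inter> nabla A v a v') \<in> S)}"

definition Pred :: "('v, 'a, 'm) arena_scheme \<Rightarrow> 'v kpair set \<Rightarrow> 'v kpair set" where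
  "Pred A S = (\<Union>v\<in>verts A. \<Union>a\<in>enabled A v. {(v, K) | K. K \<in> KPred A v a S})"

primrec W :: "('v, 'a, 'm) arena_scheme \<Rightarrow> 'v \<Rightarrow> nat \<Rightarrow> 'v kpair set" where
  "W A t 0 = {(t, {1..})} \<union> {(v, {}) | v. v \<in> verts A - {t}}"
| "W A t (Suc i) = join (W A t i) (Pred A (down (W A t i)))"

end

theory Submission
  imports Defs
begin

text \<open>Vertices and actions are finite, so \<open>\<down>W\<^sup>i\<close> is always the downward closure of a finite set,
  although \<open>Pred (\<down>W\<^sup>i)\<close> is infinite in general. Hence restricting to maximal elements loses nothing,
  and \<open>\<down>W\<^sup>i\<^sup>+\<^sup>1 = \<down>W\<^sup>i \<union> Pred (\<down>W\<^sup>i)\<close>: the iteration computes the usual attractor of the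
  target, in which the pairs \<open>(v, \<emptyset>)\<close> stand for the moves that Adam does not have. Adam has only
  finitely many answers to each action, so the complement of \<open>\<Union>i. \<down>W\<^sup>i\<close> is a trap for Eve.\<close>

section \<open>Reachability games\<close>

text \<open>Adam's vertices must lie in \<open>Domain E\<close>: at a dead end the inclusion would
  hold vacuously, whereas a play stuck there is lost for Eve.\<close>

primrec attractor :: "'p set \<Rightarrow> ('p \<times> 'p) set \<Rightarrow> 'p set \<Rightarrow> nat \<Rightarrow> 'p set" where
  "attractor P E T 0 = T"
| "attractor P E T (Suc n) = attractor P E T n \<union> {x \<in> P. \<exists>y\<in>attractor P E T n. (x, y) \<in> E}
     \<union> {x \<in> Domain E - P. E `` {x} \<subseteq> attractor P E T n}"

lemma attractor_mono: "m \<le> n \<Longrightarrow> attractor P E T m \<subseteq> attractor P E T n"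
  by (rule lift_Suc_mono_le[of "attractor P E T"]) auto

text \<open>A stage that contains \<open>y\<close> but not \<open>x\<close> shows that
  \<open>y\<close> has smaller rank, without a rank function. The second branch keeps the choice
  legal wherever a successor exists, as \<open>eve_strategy\<close> demands.\<close>

definition attractor_choice :: "'p set \<Rightarrow> ('p \<times> 'p) set \<Rightarrow> 'p set \<Rightarrow> 'p \<Rightarrow> 'p" where
  "attractor_choice P E T x =
    (if \<exists>y n. (x, y) \<in> E \<and> y \<in> attractor P E T n \<and> x \<notin> attractor P E T n
     then SOME y. \<exists>n. (x, y) \<in> E \<and> y \<in> attractor P E T n \<and> x \<notin> attractor P E T n
     else SOME y. (x, y) \<in> E)"

lemma attractor_choice_edge:
  assumes "x \<in> Domain E"
  shows "(x, attractor_choice P E T x) \<in> E"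
proof (cases "\<exists>y n. (x, y) \<in> E \<and> y \<in> attractor P E T n \<and> x \<notin> attractor P E T n")
  case True
  then show ?thesis unfolding attractor_choice_def
    using someI_ex[OF True] by auto
next
  case False
  then show ?thesis
    using assms unfolding attractor_choice_def by (auto intro: someI)
qed

lemma attractor_progress:
  assumes "x \<in> attractor P E T n" "x \<notin> T"
  shows "x \<in> Domain E"
    and "\<lbrakk>(x, y) \<in> E; x \<in> P \<Longrightarrow> y = attractor_choice P E T x\<rbrakk> \<Longrightarrow> \<exists>m<n. y \<in> attractor P E T m"
proof -
  have "\<exists>m<n. x \<notin> attractor P E T m \<and> x \<in> attractor P E T (Suc m)"
    using assms
  proof (induction n)
    case (Suc n)
    then show ?case by (cases "x \<in> attractor P E T n") (use less_Suc_eq in blast)+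
  qed simp
  then obtain m where m: "m < n" "x \<notin> attractor P E T m" "x \<in> attractor P E T (Suc m)" by blast
  from m(2,3) show "x \<in> Domain E" by auto
  assume y: "(x, y) \<in> E" "x \<in> P \<Longrightarrow> y = attractor_choice P E T x"
  show "\<exists>m<n. y \<in> attractor P E T m"
  proof (cases "x \<in> P")
    case True
    then have ex: "\<exists>y n. (x, y) \<in> E \<and> y \<in> attractor P E T n \<and> x \<notin> attractor P E T n"
      using m(2,3) by auto
    then obtain k where k: "y \<in> attractor P E T k" "x \<notin> attractor P E T k"
      using someI_ex[OF ex] y(2)[OF True] unfolding attractor_choice_def by auto
    \<comment> \<open>The stage \<open>k\<close> behind \<open>SOME\<close> need not be
      \<open>m\<close>, but it omits \<open>x\<close> while stage \<open>n\<close> contains it, so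
      monotonicity applies.\<close>
    then have "k < n" using assms(1) attractor_mono[of n k P E T] by (meson not_less subsetD)
    with k show ?thesis by blast
  next
    case False
    then show ?thesis using m y(1) by auto
  qed
qed

text \<open>The choice depends on the last vertex only, and until a target is met every step of a
  consistent play enters a strictly earlier stage.\<close>

lemma attractor_wins:
  assumes "x \<in> attractor P E T n"
  shows "eve_wins_from P E T x"
proof -
  define \<sigma> where "\<sigma> h = attractor_choice P E T (last h)" for h
  have "eve_strategy P E \<sigma>"
    by (simp add: eve_strategy_def \<sigma>_def attractor_choice_edge)
  moreover have "\<exists>i. \<rho> i \<in> T" if play: "infinite_play P E \<sigma> x \<rho>" for \<rho>
  proof -
    have "\<exists>j. \<rho> j \<in> T" if "\<rho> i \<in> attractor P E T m" for i m
      using that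
    proof (induction m arbitrary: i rule: less_induct)
      case (less m)
      show ?case
      proof (cases "\<rho> i \<in> T")
        case False
        have "(\<rho> i, \<rho> (Suc i)) \<in> E" "\<rho> i \<in> P \<Longrightarrow> \<rho> (Suc i) = attractor_choice P E T (\<rho> i)"
          using play by (simp_all add: infinite_play_def \<sigma>_def)
        from attractor_progress(2)[OF less.prems False this] show ?thesis
          using less.IH by blast
      qed blast
    qed
    with play assms show ?thesis unfolding infinite_play_def by metis
  qed
  moreover have "\<exists>y\<in>set h. y \<in> T" if play: "finite_play P E \<sigma> x h" for h
  proof -
    have "\<exists>y\<in>set h. y \<in> T" if "h ! i \<in> attractor P E T m" "i < length h" for i m
      using that
    proof (induction m arbitrary: i rule: less_induct)
      case (less m)
      show ?case
      proof (cases "h ! i \<in> T")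
        case False
        \<comment> \<open>A non-target vertex of the attractor has a successor and the last vertex
          of a finite play has none, so the play goes on after position \<open>i\<close>.\<close>
        have "h ! i \<noteq> last h"
          using attractor_progress(1)[OF less.prems(1) False] play by (auto simp: finite_play_def)
        then have i: "Suc i < length h"
          using less.prems(2) by (metis Suc_lessI diff_Suc_1 last_conv_nth length_greater_0_conv
              less_nat_zero_code list.size(3))
        then have "(h ! i, h ! Suc i) \<in> E"
          using play by (simp add: finite_play_def history_def successively_conv_nth)
        moreover have "h ! Suc i = attractor_choice P E T (h ! i)" if "h ! i \<in> P"
          using play i that by (simp add: finite_play_def \<sigma>_def take_Suc_conv_app_nth)
        ultimately show ?thesis
          using attractor_progress(2)[OF less.prems(1) False] less.IH i by blast
      qed (use less.prems in auto)
    qed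
    moreover have "h \<noteq> []" "h ! 0 = x"
      using play by (auto simp: finite_play_def history_def hd_conv_nth)
    ultimately show ?thesis using assms by blast
  qed
  ultimately show ?thesis unfolding eve_wins_from_def by blast
qed

text \<open>Against any given strategy, letting Adam always answer inside \<open>X\<close> produces
  one consistent play that stays in \<open>X\<close>; no determinacy is involved.\<close>

lemma trap_not_wins:
  assumes "x \<in> X" and avoids: "X \<inter> T = {}"
    and eve: "\<And>y. y \<in> X \<Longrightarrow> y \<in> P \<Longrightarrow> E `` {y} \<subseteq> X"
    and adam: "\<And>y. y \<in> X \<Longrightarrow> y \<notin> P \<Longrightarrow> y \<in> Domain E \<Longrightarrow> E `` {y} \<inter> X \<noteq> {}"
  shows "\<not> eve_wins_from P E T x"
proof
  assume "eve_wins_from P E T x"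
  then obtain \<sigma> where strat: "eve_strategy P E \<sigma>"
    and inf: "\<And>\<rho>. infinite_play P E \<sigma> x \<rho> \<Longrightarrow> \<exists>i. \<rho> i \<in> T"
    and fin: "\<And>h. finite_play P E \<sigma> x h \<Longrightarrow> \<exists>y\<in>set h. y \<in> T"
    unfolding eve_wins_from_def by blast
  define nxt where "nxt h = (if last h \<in> P then \<sigma> h else SOME y. (last h, y) \<in> E \<and> y \<in> X)" for h
  \<comment> \<open>\<open>H\<close> keeps growing even beyond a dead end, where its entries mean
    nothing; hence \<open>inv\<close> assumes that all earlier vertices have successors.\<close>
  define H where "H n = ((\<lambda>h. h @ [nxt h]) ^^ n) [x]" for n
  define \<rho> where "\<rho> n = last (H n)" for n
  have H_0: "H 0 = [x]" and H_Suc: "H (Suc n) = H n @ [nxt (H n)]" for n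
    by (simp_all add: H_def)
  have H_map: "H n = map \<rho> [0..<Suc n]" for n
    by (induction n) (simp_all add: H_0 H_Suc \<rho>_def)
  have H_nonempty: "H n \<noteq> []" for n by (simp add: H_map)
  have hd_H: "hd (H n) = x" for n
    by (induction n) (simp_all add: H_0 H_Suc hd_append H_nonempty)
  have last_H: "last (H n) = \<rho> n" for n by (simp add: \<rho>_def)
  have \<rho>_Suc: "\<rho> (Suc n) = nxt (H n)" for n by (simp add: \<rho>_def H_Suc)
  have \<rho>_eve: "\<rho> n \<in> P \<Longrightarrow> \<rho> (Suc n) = \<sigma> (map \<rho> [0..<Suc n])" for n
    unfolding H_map[symmetric] by (simp add: \<rho>_Suc nxt_def last_H)
  have inv: "history E (H n) \<and> \<rho> n \<in> X" if "\<forall>m<n. \<rho> m \<in> Domain E" for n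
    using that
  proof (induction n)
    case 0
    then show ?case using assms(1) by (simp add: H_0 history_def flip: last_H)
  next
    case (Suc n)
    then have hist: "history E (H n)" and X: "\<rho> n \<in> X" and dom: "\<rho> n \<in> Domain E" by auto
    have "(\<rho> n, nxt (H n)) \<in> E \<and> nxt (H n) \<in> X"
    proof (cases "\<rho> n \<in> P")
      case True
      then have "(\<rho> n, nxt (H n)) \<in> E"
        using strat[unfolded eve_strategy_def, rule_format, OF hist] dom
        by (simp add: nxt_def last_H)
      with eve[OF X True] show ?thesis by blast
    next
      case False
      from adam[OF X False dom] have "\<exists>y. (\<rho> n, y) \<in> E \<and> y \<in> X" by blast
      from someI_ex[OF this] False show ?thesis by (simp add: nxt_def last_H)
    qed
    then show ?case
      using hist by (auto simp: H_Suc \<rho>_Suc history_def successively_append_iff last_H)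
  qed
  show False
  proof (cases "\<forall>n. \<rho> n \<in> Domain E")
    case True
    then have "(\<rho> n, \<rho> (Suc n)) \<in> E" for n
      using inv[of "Suc n"]
      by (simp add: H_Suc \<rho>_Suc history_def successively_append_iff last_H H_nonempty)
    then have "infinite_play P E \<sigma> x \<rho>"
      using \<rho>_eve by (simp add: infinite_play_def H_0 flip: last_H[of 0])
    with inf True inv avoids show False by blast
  next
    case False
    \<comment> \<open>Up to the first dead end every move is legal, so \<open>H n\<close> is a
      finite play inside \<open>X\<close>.\<close>
    define n where "n = (LEAST n. \<rho> n \<notin> Domain E)"
    have n: "\<rho> n \<notin> Domain E" "\<forall>m<n. \<rho> m \<in> Domain E"
      using False LeastI_ex[of "\<lambda>n. \<rho> n \<notin> Domain E"] not_less_Least unfolding n_def by blast+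
    have "H n ! Suc i = \<sigma> (take (Suc i) (H n))" if "Suc i < length (H n)" "H n ! i \<in> P" for i
    proof -
      have "i < n" using that by (simp add: H_map)
      then have "H n ! i = \<rho> i" "H n ! Suc i = \<rho> (Suc i)"
        "take (Suc i) (H n) = map \<rho> [0..<Suc i]"
        by (simp_all add: H_map nth_append take_map del: upt_Suc)
      with \<rho>_eve[of i] that show ?thesis by metis
    qed
    then have "finite_play P E \<sigma> x (H n)"
      using inv[OF n(2)] n(1)
      by (simp add: finite_play_def last_H hd_H)
    from fin[OF this] obtain m where "m \<le> n" "\<rho> m \<in> T"
      by (auto simp: H_map less_Suc_eq_le simp del: upt_Suc)
    moreover have "\<rho> m \<in> X" using inv[of m] n(2) \<open>m \<le> n\<close> by auto
    ultimately show False using avoids by blast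
  qed
qed


section \<open>Finitely generated downward closed sets\<close>

lemma kle_refl: "x \<preceq> x" and kle_trans: "x \<preceq> y \<Longrightarrow> y \<preceq> z \<Longrightarrow> x \<preceq> z"
  and kle_antisym: "x \<preceq> y \<Longrightarrow> y \<preceq> x \<Longrightarrow> x = y"
  by (auto simp: kle_def prod_eq_iff)

lemma in_down_iff: "x \<in> down L \<longleftrightarrow> (\<exists>y\<in>L. x \<preceq> y)"
  unfolding down_def Dom_def using kle_refl by blast

lemma down_Un: "down (L \<union> L') = down L \<union> down L'"
  by (auto simp: in_down_iff)

lemma down_idem: "down (down L) = down L"
proof
  show "down (down L) \<subseteq> down L" using kle_trans by (fastforce simp: in_down_iff)
qed (simp add: down_def)

text \<open>Infinite ascending chains are the danger. A maximal element of \<open>F\<close> above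
  \<open>x\<close> is below some element of \<open>L\<close>, which is below some element of
  \<open>F\<close>; maximality makes all three equal, so it is also a maximal element of
  \<open>L\<close>.\<close>

lemma down_maximals:
  assumes "finite F" and F: "down L = down F"
  shows "down (maximals L) = down L"
proof
  show "down (maximals L) \<subseteq> down L" by (auto simp: in_down_iff maximals_def)
  show "down L \<subseteq> down (maximals L)"
  proof
    fix x assume "x \<in> down L"
    then obtain f0 where f0: "f0 \<in> F" "x \<preceq> f0" unfolding F in_down_iff by blast
    define S where "S = {f \<in> F. x \<preceq> f}"
    have "finite S" "S \<noteq> {}" using assms(1) f0 unfolding S_def by (simp, blast)
    \<comment> \<open>All elements of \<open>S\<close> share their first component with
      \<open>x\<close>, so inclusion of second components is the whole order on
      \<open>S\<close>.\<close>
    then obtain M where M: "M \<in> snd ` S" "\<And>N. N \<in> snd ` S \<Longrightarrow> M \<subseteq> N \<Longrightarrow> M = N"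
      using finite_has_maximal[of "snd ` S"] by auto
    then obtain f where f: "f \<in> S" "snd f = M" by blast
    have max: "g = f" if "g \<in> S" "f \<preceq> g" for g
      using M(2)[of "snd g"] f that by (auto simp: kle_def prod_eq_iff)
    have fmax: "z = f" if "z \<in> L" "f \<preceq> z" for z
    proof -
      from that(1) have "z \<in> down F" unfolding F[symmetric] by (simp add: down_def)
      then obtain g where g: "g \<in> F" "z \<preceq> g" unfolding in_down_iff by blast
      then have "g = f" using max[of g] f(1) that(2) kle_trans unfolding S_def by blast
      then show ?thesis using g that(2) kle_antisym by blast
    qed
    have "f \<in> down L" unfolding F using f(1) by (simp add: S_def down_def)
    then have "f \<in> L" using fmax unfolding in_down_iff by blast
    then have "f \<in> maximals L" using fmax by (auto simp: maximals_def Dom_def)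
    then show "x \<in> down (maximals L)" using f(1) by (auto simp: in_down_iff S_def)
  qed
qed


section \<open>The fixpoint iteration\<close>

context param_arena
begin

text \<open>The generator attached to \<open>v\<close>, \<open>a\<close> and \<open>G\<close> is the largest \<open>K\<close> for which each element of \<open>G\<close>
  bounds the successor of \<open>(v, K, a)\<close> with the same vertex.\<close>

lemma Pred_finitely_generated:
  assumes "finite F"
  obtains F' where "finite F'" "Pred A (down F) = down F'"
proof
  define gen where "gen = (\<lambda>(v, a, G). (v, {k. 1 \<le> k \<and>
    (\<forall>f\<in>G. k \<in> nabla A v a (fst f) \<longrightarrow> k \<in> snd f)}))"
  \<comment> \<open>\<open>G\<close> must meet every vertex: one without an element in
    \<open>G\<close> would leave the corresponding successor unbounded.\<close>
  define I where "I = {(v, a, G). v \<in> verts A \<and> a \<in> enabled A v \<and> G \<subseteq> F \<and> verts A \<subseteq> fst ` G}"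
  have "I \<subseteq> verts A \<times> acts A \<times> Pow F" by (auto simp: I_def enabled_def)
  then show "finite (gen ` I)"
    using finite_verts finite_acts assms by (meson finite_Pow_iff finite_SigmaI finite_imageI finite_subset)
  show "Pred A (down F) = down (gen ` I)"
  proof (intro subset_antisym subsetI)
    fix x assume "x \<in> Pred A (down F)"
    then obtain v a K where x: "x = (v, K)" "v \<in> verts A" "a \<in> enabled A v" "K \<subseteq> {1..}"
      and "\<forall>v'\<in>verts A. \<exists>f\<in>F. (v', K \<inter> nabla A v a v') \<preceq> f"
      by (auto simp: Pred_def KPred_def in_down_iff)
    \<comment> \<open>\<open>c\<close> picks one bound for each successor vertex, and its image
      serves as \<open>G\<close>. By \<open>fst_c\<close> each \<open>c v'\<close> constrains the
      generator only through \<open>v'\<close>, where it bounds the successor of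
      \<open>(v, K, a)\<close>.\<close>
    then obtain c where c: "\<And>v'. v' \<in> verts A \<Longrightarrow> c v' \<in> F \<and> (v', K \<inter> nabla A v a v') \<preceq> c v'"
      by metis
    then have fst_c: "fst (c v') = v'" if "v' \<in> verts A" for v'
      using that by (metis fst_conv kle_def)
    have "verts A \<subseteq> fst ` c ` verts A" using fst_c by (auto simp: image_image)
    then have "(v, a, c ` verts A) \<in> I" using x c by (auto simp: I_def)
    moreover have "x \<preceq> gen (v, a, c ` verts A)"
      using x c fst_c by (fastforce simp: gen_def kle_def)
    ultimately show "x \<in> down (gen ` I)" unfolding in_down_iff by blast
  next
    fix x assume "x \<in> down (gen ` I)"
    then obtain v a G where I: "(v, a, G) \<in> I" and x: "x \<preceq> gen (v, a, G)"
      by (auto simp: in_down_iff)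
    have "\<exists>f\<in>F. (v', snd x \<inter> nabla A v a v') \<preceq> f" if v': "v' \<in> verts A" for v'
    proof -
      obtain f where "f \<in> G" "fst f = v'" using v' I by (auto simp: I_def)
      then show ?thesis
        using I x by (intro bexI[of _ f]) (auto simp: I_def gen_def kle_def)
    qed
    then have "(v, snd x) \<in> Pred A (down F)"
      using I x by (auto simp: Pred_def KPred_def in_down_iff I_def gen_def kle_def subset_iff)
    moreover have "(v, snd x) = x" using x by (simp add: gen_def kle_def prod_eq_iff)
    ultimately show "x \<in> Pred A (down F)" by simp
  qed
qed

text \<open>The two facts feed each other: finite generation of stage \<open>i\<close> lets the join
  drop non-maximal elements without loss, and the resulting union is again finitely
  generated.\<close>

lemma down_W_finitely_generated: "\<exists>F. finite F \<and> down (W A t i) = down F"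
  and down_W_Suc: "down (W A t (Suc i)) = down (W A t i) \<union> Pred A (down (W A t i))"
proof -
  have step: "(\<exists>F'. finite F' \<and> down (W A t (Suc i)) = down F') \<and>
      down (W A t (Suc i)) = down (W A t i) \<union> Pred A (down (W A t i))"
    if F: "finite F" "down (W A t i) = down F" for F i
  proof -
    obtain F' where F': "finite F'" "Pred A (down F) = down F'"
      using Pred_finitely_generated[OF F(1)] .
    have un: "down (W A t i \<union> Pred A (down (W A t i))) = down (F \<union> F')"
      by (simp add: down_Un F F' down_idem)
    have "down (W A t (Suc i)) = down (F \<union> F')"
      using down_maximals[OF _ un] F(1) F'(1) un by (simp add: join_def)
    then show ?thesis using F F' by (auto simp: down_Un)
  qed
  show fg: "\<exists>F. finite F \<and> down (W A t i) = down F" for i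
  proof (induction i)
    case 0
    have "finite (W A t 0)" using finite_verts by simp
    then show ?case by blast
  next
    case (Suc i)
    then show ?case using step by blast
  qed
  show "down (W A t (Suc i)) = down (W A t i) \<union> Pred A (down (W A t i))"
    using fg[of i] step by blast
qed

lemma down_W_mono: "i \<le> j \<Longrightarrow> down (W A t i) \<subseteq> down (W A t j)"
  by (rule lift_Suc_mono_le[of "\<lambda>i. down (W A t i)"]) (simp add: down_W_Suc del: W.simps)

lemma empty_in_down_W: "v \<in> verts A \<Longrightarrow> (v, {}) \<in> down (W A t i)"
  by (rule subsetD[OF down_W_mono[of 0 i t]]) (auto simp: in_down_iff kle_def)

lemma target_in_down_W: "K \<subseteq> {1..} \<Longrightarrow> (t, K) \<in> down (W A t i)"
  by (rule subsetD[OF down_W_mono[of 0 i t]]) (auto simp: in_down_iff kle_def)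

text \<open>The factor 2 arises because one iteration covers a move of Eve and an answer of Adam.
  Nonempty \<open>K\<close> excludes the pairs \<open>(v, {})\<close>, which lie in every stage
  although Eve need not win from them.\<close>

lemma down_W_imp_attractor:
  assumes "complete_arena A"
  shows "\<lbrakk>(v, K) \<in> down (W A t i); K \<noteq> {}\<rbrakk> \<Longrightarrow>
    Eve v K \<in> attractor (eve_vertices A) (knowledge_edges A) (knowledge_targets t) (2 * i)"
proof (induction i arbitrary: v K)
  case 0
  then show ?case by (auto simp: in_down_iff kle_def knowledge_targets_def)
next
  case (Suc i)
  let ?R = "attractor (eve_vertices A) (knowledge_edges A) (knowledge_targets t)"
  show ?case
  proof (cases "(v, K) \<in> down (W A t i)")
    case True
    then show ?thesis using Suc.IH[OF True Suc.prems(2)] by simp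
  next
    case False
    then obtain a where v: "v \<in> verts A" and a: "a \<in> enabled A v" and K: "K \<subseteq> {1..}"
      and succ: "\<And>v'. v' \<in> verts A \<Longrightarrow> (v', K \<inter> nabla A v a v') \<in> down (W A t i)"
      using Suc.prems(1) unfolding down_W_Suc by (auto simp: Pred_def KPred_def)
    have acts: "a \<in> acts A" using a by (simp add: enabled_def)
    \<comment> \<open>Completeness at one \<open>k\<close> in \<open>K\<close> gives Adam a move, so
      his vertex is not a dead end.\<close>
    obtain k where k: "k \<in> K" "1 \<le> k" using Suc.prems(2) K by auto
    then obtain v' where v': "v' \<in> succs A v a k"
      using assms v a unfolding complete_arena_def by blast
    then have "v' \<in> verts A" using succs_verts[OF v acts k(2)] by blast
    moreover have "K \<inter> nabla A v a v' \<noteq> {}" using k v' by (auto simp: nabla_def)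
    ultimately have "(Adam v K a, Eve v' (K \<inter> nabla A v a v')) \<in> knowledge_edges A"
      using v K acts by (auto simp: knowledge_edges_def)
    \<comment> \<open>Adam's edges lead only to nonempty knowledge, so the induction hypothesis
      covers all his answers.\<close>
    moreover have "knowledge_edges A `` {Adam v K a} \<subseteq> ?R (2 * i)"
      using Suc.IH succ by (auto simp: knowledge_edges_def)
    ultimately have "Adam v K a \<in> ?R (Suc (2 * i))" by (auto simp: eve_vertices_def)
    moreover have "(Eve v K, Adam v K a) \<in> knowledge_edges A"
      using v K a by (auto simp: knowledge_edges_def)
    moreover have "Eve v K \<in> eve_vertices A" using v K by (simp add: eve_vertices_def)
    ultimately have "Eve v K \<in> ?R (Suc (Suc (2 * i)))"
      unfolding attractor.simps(2)[of _ _ _ "Suc (2 * i)"] by blast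
    then show ?thesis by (simp del: attractor.simps)
  qed
qed

text \<open>This is where finiteness of the set of vertices bounds the number of iterations by \<open>\<omega>\<close>.\<close>

lemma UN_down_W_closed:
  assumes "v \<in> verts A" "a \<in> enabled A v" "K \<subseteq> {1..}"
    and "\<And>v'. v' \<in> verts A \<Longrightarrow> (v', K \<inter> nabla A v a v') \<in> (\<Union>i. down (W A t i))"
  shows "(v, K) \<in> (\<Union>i. down (W A t i))"
proof -
  have "\<forall>v'\<in>verts A. \<exists>i. (v', K \<inter> nabla A v a v') \<in> down (W A t i)"
    using assms(4) by blast
  from bchoice[OF this] obtain r where
    r: "\<And>v'. v' \<in> verts A \<Longrightarrow> (v', K \<inter> nabla A v a v') \<in> down (W A t (r v'))"
    by blast
  define n where "n = Max (r ` verts A)"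
  have "r v' \<le> n" if "v' \<in> verts A" for v'
    using that finite_verts by (simp add: n_def)
  then have "(v', K \<inter> nabla A v a v') \<in> down (W A t n)" if "v' \<in> verts A" for v'
    using r[OF that] down_W_mono[of "r v'" n t] that by blast
  then have "(v, K) \<in> Pred A (down (W A t n))" using assms by (auto simp: Pred_def KPred_def)
  then have "(v, K) \<in> down (W A t (Suc n))" unfolding down_W_Suc by blast
  then show ?thesis by blast
qed

text \<open>Eve's vertices outside the union and Adam's vertices with an answer outside it form a
  trap, since the union is closed under predecessors.\<close>

lemma not_in_down_W_imp_not_wins:
  assumes "v \<in> verts A" "K \<subseteq> {1..}" "(v, K) \<notin> (\<Union>i. down (W A t i))"
  shows "\<not> eve_wins_knowledge A t v K"
proof -
  let ?Y = "\<Union>i. down (W A t i)"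
  define X where "X = {Eve v K | v K. v \<in> verts A \<and> K \<subseteq> {1..} \<and> (v, K) \<notin> ?Y} \<union>
    {Adam v K a | v K a. v \<in> verts A \<and> K \<subseteq> {1..} \<and> a \<in> acts A \<and>
      (\<exists>v'\<in>verts A. (v', K \<inter> nabla A v a v') \<notin> ?Y)}"
  show ?thesis unfolding eve_wins_knowledge_def
  proof (rule trap_not_wins[where X = X])
    show "Eve v K \<in> X" using assms by (simp add: X_def)
    show "X \<inter> knowledge_targets t = {}"
      using target_in_down_W by (auto simp: X_def knowledge_targets_def)
    show "knowledge_edges A `` {y} \<subseteq> X" if y: "y \<in> X" "y \<in> eve_vertices A" for y
    proof
      fix z assume "z \<in> knowledge_edges A `` {y}"
      with y(2) obtain v K a where z: "y = Eve v K" "z = Adam v K a" "v \<in> verts A" "K \<subseteq> {1..}"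
        "a \<in> enabled A v"
        by (auto simp: knowledge_edges_def eve_vertices_def)
      then have "(v, K) \<notin> ?Y" using y(1) by (simp add: X_def)
      then have "\<exists>v'\<in>verts A. (v', K \<inter> nabla A v a v') \<notin> ?Y"
        using UN_down_W_closed[OF z(3,5,4)] by blast
      then show "z \<in> X" using z by (auto simp: X_def enabled_def)
    qed
    show "knowledge_edges A `` {y} \<inter> X \<noteq> {}" if y: "y \<in> X" "y \<notin> eve_vertices A" for y
    proof -
      from y obtain v K a v' where y: "y = Adam v K a" "v \<in> verts A" "K \<subseteq> {1..}" "a \<in> acts A"
        and v': "v' \<in> verts A" "(v', K \<inter> nabla A v a v') \<notin> ?Y"
        by (auto simp: X_def eve_vertices_def)
      \<comment> \<open>Since \<open>?Y\<close> contains every pair with empty knowledge, the answer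
        outside \<open>?Y\<close> has nonempty knowledge and is a legal move.\<close>
      have "(v', {}) \<in> ?Y" using empty_in_down_W[OF v'(1)] by blast
      with v'(2) have "K \<inter> nabla A v a v' \<noteq> {}" by metis
      then have "(y, Eve v' (K \<inter> nabla A v a v')) \<in> knowledge_edges A"
        using y v' by (auto simp: knowledge_edges_def)
      moreover have "Eve v' (K \<inter> nabla A v a v') \<in> X" using y v' by (auto simp: X_def)
      ultimately show ?thesis by blast
    qed
  qed
qed

end

theorem theorem14:
  fixes A :: "('v, 'a) arena" and t v :: 'v and K :: "nat set"
  assumes "param_arena A" and "complete_arena A" and "t \<in> verts A"
    and "v \<in> verts A" and "K \<subseteq> {1..}" and "K \<noteq> {}"
  shows "eve_wins_knowledge A t v K \<longleftrightarrow> (\<exists>i. (v, K) \<in> down (W A t i))"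
proof -
  interpret param_arena A by (rule assms(1))
  show ?thesis
  proof
    assume "eve_wins_knowledge A t v K"
    then show "\<exists>i. (v, K) \<in> down (W A t i)"
      using not_in_down_W_imp_not_wins[OF assms(4,5), of t] by blast
  next
    assume "\<exists>i. (v, K) \<in> down (W A t i)"
    then obtain i where "(v, K) \<in> down (W A t i)" ..
    from attractor_wins[OF down_W_imp_attractor[OF assms(2) this assms(6)]]
    show "eve_wins_knowledge A t v K" unfolding eve_wins_knowledge_def .
  qed
qed

end
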